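(* Let $C_n$ be a signed cycle with vertices $v_1,\dots,v_n$ in cyclic order, and let $T_{m_1},T_{m_2}$ be vertex-disjoint signed trees with $m_1,m_2$ vertices. Let $U=U(C_n,T_{m_1},T_{m_2},l)$ be the signed unicyclic graph obtained by joining the root of $T_{m_1}$ by an edge to $v_1$ and the root of $T_{m_2}$ by an edge to $v_{l+1}$, where $v_1$ and $v_{l+1}$ are at distance $l\ge1$ on the cycle. Then $$\det U=\det\big(U(C_n,T_{m_2})\big)\det(T_{m_1})+\det(\{T_{m_1},v_1\})\det(\{T_{m_2},v_{l+1}\})\det(P_{l-1})\det(P_{n-l-1})+\det(\{T_{m_1},v_1\})\det(T_{m_2})\det(P_{n-1}).$$
   Context: A signed graph has edge weights in $\{1,-1\}$ and its determinant is that of its adjacency matrix; the determinant of the empty graph is $1$. $U(C_n,T_{m_2})$ is the subgraph of $U$ obtained by deleting $T_{m_1}$. $\{T,w\}$ denotes the subgraph induced by the vertices of tree $T$ together with vertex $w$. $P_{n-1}$ is the signed path $C_n\setminus v_1$; $P_{l-1}$ and $P_{n-l-1}$ are the two signed paths forming $C_n\setminus\{v_1,v_{l+1}\}$ (on $l-1$ and $n-l-1$ vertices). *)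

theory Defs
  imports
    "Jordan_Normal_Form.Determinant"
    "HOL-Combinatorics.Permutations"
begin

text \<open>
  Edges are two-element vertex sets. The weight function is total on sets; only its values on
  edges are meaningful.
\<close>

record 'a sgraph =
  verts :: "'a set"
  edges :: "'a set set"
  weight :: "'a set \<Rightarrow> int"

definition signed_graph :: "'a sgraph \<Rightarrow> bool" where
  "signed_graph G \<longleftrightarrow>
     finite (verts G) \<and>
     (\<forall>e\<in>edges G. e \<subseteq> verts G \<and> card e = 2 \<and> weight G e \<in> {1, -1})"

definition adj :: "'a sgraph \<Rightarrow> 'a \<Rightarrow> 'a \<Rightarrow> int" where
  "adj G u w = (if {u, w} \<in> edges G then weight G {u, w} else 0)"

definition adj_mat :: "'a sgraph \<Rightarrow> 'a list \<Rightarrow> int mat" where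
  "adj_mat G xs = mat (length xs) (length xs) (\<lambda>(i, j). adj G (xs ! i) (xs ! j))"

text \<open>
  The enumeration of the vertices is immaterial, see \<open>graph_det_eq\<close> below.
\<close>

definition graph_det :: "'a sgraph \<Rightarrow> int" where
  "graph_det G = det (adj_mat G (SOME xs. distinct xs \<and> set xs = verts G))"

lemma det_adj_mat_enumeration:
  assumes "distinct xs" "distinct ys" "set xs = set ys"
  shows "det (adj_mat G xs) = det (adj_mat G ys)"
proof -
  have "mset ys = mset xs"
    using assms by (simp add: set_eq_iff_mset_eq_distinct)
  then obtain p where p: "p permutes {..<length xs}" and ys: "permute_list p xs = ys"
    by (rule mset_eq_permutation)
  define n where "n = length xs"
  have p': "p permutes {0..<n}"
    using p by (simp add: n_def atLeast0LessThan)
  have pn: "p i < n" if "i < n" for i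
    using permutes_in_image[OF p', of i] that by simp
  define A where "A = adj_mat G xs"
  have A: "A \<in> carrier_mat n n"
    by (simp add: A_def adj_mat_def n_def)
  define B where "B = mat n n (\<lambda>(i, j). A $$ (p i, j))"
  have B: "B \<in> carrier_mat n n"
    by (simp add: B_def)
  have BT: "transpose_mat B \<in> carrier_mat n n"
    using B by simp
  define D where "D = mat n n (\<lambda>(i, j). transpose_mat B $$ (p i, j))"
  have "D = transpose_mat (adj_mat G ys)"
  proof (rule eq_matI)
    fix i j
    assume "i < dim_row (transpose_mat (adj_mat G ys))"
      and "j < dim_col (transpose_mat (adj_mat G ys))"
    then have ij: "i < n" "j < n"
      by (auto simp: adj_mat_def n_def simp flip: ys)
    have nth: "ys ! k = xs ! p k" if "k < n" for k
      using permute_list_nth[OF p] that by (simp add: n_def flip: ys)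
    have "length ys = n"
      by (simp add: n_def flip: ys)
    then show "D $$ (i, j) = transpose_mat (adj_mat G ys) $$ (i, j)"
      using ij pn nth by (simp add: D_def B_def A_def adj_mat_def flip: n_def)
  qed (auto simp: D_def adj_mat_def n_def simp flip: ys)
  moreover have "det D = signof p * det B"
    unfolding D_def using det_permute_rows[OF BT p'] det_transpose[OF B] by simp
  moreover have "det B = signof p * det A"
    unfolding B_def by (rule det_permute_rows[OF A p'])
  moreover have "det (transpose_mat (adj_mat G ys)) = det (adj_mat G ys)"
    by (rule det_transpose[of _ "length ys"]) (simp add: adj_mat_def)
  moreover have "signof p * (signof p * det A) = det A"
    by (simp add: sign_def)
  ultimately show ?thesis
    by (simp add: A_def)
qed

lemma graph_det_eq:
  assumes "distinct xs" "set xs = verts G"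
  shows "graph_det G = det (adj_mat G xs)"
proof -
  have "distinct (SOME xs. distinct xs \<and> set xs = verts G) \<and>
        set (SOME xs. distinct xs \<and> set xs = verts G) = verts G"
    by (rule someI[of _ xs]) (simp add: assms)
  then show ?thesis
    unfolding graph_det_def using assms by (intro det_adj_mat_enumeration) auto
qed

lemma graph_det_empty: "verts G = {} \<Longrightarrow> graph_det G = 1"
  by (subst graph_det_eq[of "[]"]) (auto simp: adj_mat_def)

definition induced :: "'a sgraph \<Rightarrow> 'a set \<Rightarrow> 'a sgraph" where
  "induced G S = G\<lparr>verts := verts G \<inter> S, edges := {e \<in> edges G. e \<subseteq> S}\<rparr>"

definition delete :: "'a sgraph \<Rightarrow> 'a set \<Rightarrow> 'a sgraph" where
  "delete G S = induced G (verts G - S)"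

definition walk :: "'a sgraph \<Rightarrow> 'a \<Rightarrow> 'a list \<Rightarrow> 'a \<Rightarrow> bool" where
  "walk G u xs w \<longleftrightarrow>
     xs \<noteq> [] \<and> hd xs = u \<and> last xs = w \<and> set xs \<subseteq> verts G \<and>
     (\<forall>i. Suc i < length xs \<longrightarrow> {xs ! i, xs ! Suc i} \<in> edges G)"

definition connected_graph :: "'a sgraph \<Rightarrow> bool" where
  "connected_graph G \<longleftrightarrow>
     verts G \<noteq> {} \<and> (\<forall>u\<in>verts G. \<forall>w\<in>verts G. \<exists>xs. walk G u xs w)"

text \<open>Only used for vertices of the same component.\<close>

definition graph_dist :: "'a sgraph \<Rightarrow> 'a \<Rightarrow> 'a \<Rightarrow> nat" where
  "graph_dist G u w = (LEAST k. \<exists>xs. walk G u xs w \<and> length xs = Suc k)"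

definition has_cycle :: "'a sgraph \<Rightarrow> bool" where
  "has_cycle G \<longleftrightarrow>
     (\<exists>xs. length xs \<ge> 3 \<and> distinct xs \<and> walk G (hd xs) xs (last xs) \<and>
       {last xs, hd xs} \<in> edges G)"

definition signed_tree :: "'a sgraph \<Rightarrow> bool" where
  "signed_tree T \<longleftrightarrow> signed_graph T \<and> connected_graph T \<and> \<not> has_cycle T"

definition signed_cycle :: "'a sgraph \<Rightarrow> nat \<Rightarrow> (nat \<Rightarrow> 'a) \<Rightarrow> bool" where
  "signed_cycle C n v \<longleftrightarrow>
     signed_graph C \<and> n \<ge> 3 \<and> inj_on v {1..n} \<and> verts C = v ` {1..n} \<and>
     edges C = {{v i, v (i + 1)} | i. 1 \<le> i \<and> i < n} \<union> {{v n, v 1}}"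

text \<open>Intended for vertex-disjoint \<open>G\<close> and \<open>H\<close>.\<close>

definition join_edge :: "'a sgraph \<Rightarrow> 'a \<Rightarrow> 'a sgraph \<Rightarrow> 'a \<Rightarrow> int \<Rightarrow> 'a sgraph" where
  "join_edge G u H w s =
     \<lparr>verts = verts G \<union> verts H,
      edges = edges G \<union> edges H \<union> {{u, w}},
      weight = (\<lambda>e. if e = {u, w} then s else if e \<in> edges G then weight G e else weight H e)\<rparr>"

lemma signed_graph_join_edge:
  assumes "signed_graph G" "signed_graph H" "verts G \<inter> verts H = {}"
    and "u \<in> verts G" "w \<in> verts H" "s \<in> {1, -1}"
  shows "signed_graph (join_edge G u H w s)"
proof -
  have "u \<noteq> w" using assms by auto
  then show ?thesis using assms by (auto simp: signed_graph_def join_edge_def)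
qed

text \<open>
  \<open>s1\<close> and \<open>s2\<close> are the weights of the edges joining the roots \<open>r1\<close> and \<open>r2\<close> to the cycle.
\<close>

definition unicyclic ::
  "'a sgraph \<Rightarrow> (nat \<Rightarrow> 'a) \<Rightarrow> nat \<Rightarrow> 'a sgraph \<Rightarrow> 'a \<Rightarrow> int \<Rightarrow> 'a sgraph \<Rightarrow> 'a \<Rightarrow> int \<Rightarrow> 'a sgraph"
  where
  "unicyclic C v l T1 r1 s1 T2 r2 s2 =
     join_edge (join_edge C (v (l + 1)) T2 r2 s2) (v 1) T1 r1 s1"

end

theory Submission
  imports Defs
begin

text \<open>
  If \<open>x\<close> is a cut vertex separating the vertex sets \<open>A\<close> and \<open>B\<close>, splitting the row of \<open>x\<close> of the
  adjacency matrix into its \<open>A\<close>-part and its \<open>B\<close>-part writes the determinant as a sum of two block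
  triangular ones, so \<open>det (A x B) = det (A x) * det B + det A * det (x B)\<close>. The formula for \<open>U\<close>
  arises by applying this at \<open>v 1\<close>, and then at \<open>v (l + 1)\<close> to what remains after deleting
  \<open>T1\<close> and \<open>v 1\<close>.
\<close>

section \<open>Determinants of matrices indexed by a list of vertices\<close>

definition list_mat :: "('a \<Rightarrow> 'a \<Rightarrow> 'b) \<Rightarrow> 'a list \<Rightarrow> 'b mat" where
  "list_mat f xs = mat (length xs) (length xs) (\<lambda>(i, j). f (xs ! i) (xs ! j))"

lemma list_mat_carrier [simp]: "list_mat f xs \<in> carrier_mat (length xs) (length xs)"
  by (simp add: list_mat_def)

lemma adj_mat_eq_list_mat: "adj_mat G xs = list_mat (adj G) xs"
  by (simp add: adj_mat_def list_mat_def)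

lemma list_mat_cong:
  assumes "\<And>x y. x \<in> set xs \<Longrightarrow> y \<in> set xs \<Longrightarrow> f x y = g x y"
  shows "list_mat f xs = list_mat g xs"
  unfolding list_mat_def by (rule cong_mat) (auto intro: assms)

lemma list_mat_append:
  "list_mat f (xs @ ys) =
     four_block_mat (list_mat f xs)
       (mat (length xs) (length ys) (\<lambda>(i, j). f (xs ! i) (ys ! j)))
       (mat (length ys) (length xs) (\<lambda>(i, j). f (ys ! i) (xs ! j)))
       (list_mat f ys)"
  by (rule eq_matI) (auto simp: list_mat_def four_block_mat_def Let_def nth_append)

lemma det_list_mat_append_upper_zero:
  fixes f :: "'a \<Rightarrow> 'a \<Rightarrow> 'b :: idom"
  assumes "\<And>x y. x \<in> set xs \<Longrightarrow> y \<in> set ys \<Longrightarrow> f x y = 0"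
  shows "det (list_mat f (xs @ ys)) = det (list_mat f xs) * det (list_mat f ys)"
proof -
  have "mat (length xs) (length ys) (\<lambda>(i, j). f (xs ! i) (ys ! j)) = 0\<^sub>m (length xs) (length ys)"
    by (rule eq_matI) (auto intro: assms)
  then show ?thesis
    unfolding list_mat_append by (intro det_four_block_mat_upper_right_zero) auto
qed

lemma det_list_mat_append_lower_zero:
  fixes f :: "'a \<Rightarrow> 'a \<Rightarrow> 'b :: idom"
  assumes "\<And>x y. x \<in> set ys \<Longrightarrow> y \<in> set xs \<Longrightarrow> f x y = 0"
  shows "det (list_mat f (xs @ ys)) = det (list_mat f xs) * det (list_mat f ys)"
proof -
  have "mat (length ys) (length xs) (\<lambda>(i, j). f (ys ! i) (xs ! j)) = 0\<^sub>m (length ys) (length xs)"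
    by (rule eq_matI) (auto intro: assms)
  then show ?thesis
    unfolding list_mat_append by (intro det_four_block_mat_lower_left_zero) auto
qed

text \<open>Additivity of the determinant in one row, by the Leibniz formula: each product has
  exactly one factor from row \<open>z\<close>, and its other factors agree for \<open>f\<close>,
  \<open>g\<close> and \<open>h\<close>. Distinctness of \<open>xs\<close> makes \<open>z\<close>
  label a single row.\<close>

lemma det_list_mat_row_add:
  fixes f g h :: "'a \<Rightarrow> 'a \<Rightarrow> 'b :: comm_ring_1"
  assumes "distinct xs" "z \<in> set xs"
    and row: "\<And>y. f z y = g z y + h z y"
    and other: "\<And>x y. x \<noteq> z \<Longrightarrow> f x y = g x y" "\<And>x y. x \<noteq> z \<Longrightarrow> f x y = h x y"
  shows "det (list_mat f xs) = det (list_mat g xs) + det (list_mat h xs)"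
proof -
  let ?n = "length xs"
  obtain k where k: "k < ?n" "xs ! k = z"
    using assms(2) by (auto simp: in_set_conv_nth)
  have neq: "xs ! i \<noteq> z" if "i < ?n" "i \<noteq> k" for i
    using assms(1) k that by (auto simp: nth_eq_iff_index_eq)
  have split: "(\<Prod>i = 0..<?n. F (xs ! i) (xs ! p i)) =
      F z (xs ! p k) * (\<Prod>i \<in> {0..<?n} - {k}. F (xs ! i) (xs ! p i))"
    for F :: "'a \<Rightarrow> 'a \<Rightarrow> 'b" and p
    using k by (subst prod.remove[of _ k]) auto
  have add: "(\<Prod>i = 0..<?n. f (xs ! i) (xs ! p i)) =
      (\<Prod>i = 0..<?n. g (xs ! i) (xs ! p i)) + (\<Prod>i = 0..<?n. h (xs ! i) (xs ! p i))" for p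
  proof -
    have "(\<Prod>i \<in> {0..<?n} - {k}. f (xs ! i) (xs ! p i)) =
        (\<Prod>i \<in> {0..<?n} - {k}. g (xs ! i) (xs ! p i))"
      by (rule prod.cong) (simp_all add: other(1) neq)
    moreover have "(\<Prod>i \<in> {0..<?n} - {k}. f (xs ! i) (xs ! p i)) =
        (\<Prod>i \<in> {0..<?n} - {k}. h (xs ! i) (xs ! p i))"
      by (rule prod.cong) (simp_all add: other(2) neq)
    ultimately show ?thesis
      by (simp only: split[of f] split[of g] split[of h] row distrib_right)
  qed
  have det: "det (list_mat F xs) = (\<Sum>p | p permutes {0..<?n}.
      signof p * (\<Prod>i = 0..<?n. F (xs ! i) (xs ! p i)))" for F :: "'a \<Rightarrow> 'a \<Rightarrow> 'b"
    unfolding det_def'[OF list_mat_carrier]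
    by (intro sum.cong refl arg_cong2[of _ _ _ _ "(*)"] prod.cong)
       (auto simp: list_mat_def permutes_in_image)
  show ?thesis
    unfolding det add by (simp add: distrib_left sum.distrib)
qed

lemma det_list_mat_cut_vertex:
  fixes f :: "'a \<Rightarrow> 'a \<Rightarrow> 'b :: idom"
  assumes dist: "distinct (xs @ [z] @ ys)" and zz: "f z z = 0"
    and xy: "\<And>x y. x \<in> set xs \<Longrightarrow> y \<in> set ys \<Longrightarrow> f x y = 0"
    and yx: "\<And>x y. x \<in> set xs \<Longrightarrow> y \<in> set ys \<Longrightarrow> f y x = 0"
  shows "det (list_mat f (xs @ [z] @ ys)) =
    det (list_mat f (xs @ [z])) * det (list_mat f ys) +
    det (list_mat f xs) * det (list_mat f ([z] @ ys))"
proof -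
  \<comment> \<open>In row \<open>z\<close>, \<open>g\<close> keeps the columns of \<open>xs\<close>
    and \<open>z\<close>, while \<open>h\<close> keeps those of \<open>ys\<close>. They are in
    general not symmetric, so not adjacency functions of graphs; hence \<open>list_mat\<close> takes
    an arbitrary function.\<close>
  define g where "g = (\<lambda>x y. if x = z \<and> y \<in> set ys then 0 else f x y)"
  define h where "h = (\<lambda>x y. if x = z \<and> y \<notin> set ys then 0 else f x y)"
  have "det (list_mat f (xs @ [z] @ ys)) =
      det (list_mat g ((xs @ [z]) @ ys)) + det (list_mat h (xs @ [z] @ ys))"
    unfolding append_assoc
    by (rule det_list_mat_row_add[where z = z]) (use dist in \<open>auto simp: g_def h_def\<close>)
  \<comment> \<open>Here \<open>z\<close> belongs to the first block: the upper right block vanishes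
    by \<open>xy\<close> in the rows of \<open>xs\<close> and by the choice of \<open>g\<close> in
    row \<open>z\<close>.\<close>
  also have "det (list_mat g ((xs @ [z]) @ ys)) = det (list_mat g (xs @ [z])) * det (list_mat g ys)"
    using dist by (intro det_list_mat_append_upper_zero) (auto simp: g_def xy)
  also have "list_mat g (xs @ [z]) = list_mat f (xs @ [z])"
    using dist by (intro list_mat_cong) (auto simp: g_def)
  also have "list_mat g ys = list_mat f ys"
    using dist by (intro list_mat_cong) (auto simp: g_def)
  \<comment> \<open>Here \<open>z\<close> moves to the second block, and the lower left block
    vanishes.\<close>
  also have "det (list_mat h (xs @ [z] @ ys)) = det (list_mat h xs) * det (list_mat h ([z] @ ys))"
    using dist by (intro det_list_mat_append_lower_zero) (auto simp: h_def yx)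
  also have "list_mat h xs = list_mat f xs"
    using dist by (intro list_mat_cong) (auto simp: h_def)
  \<comment> \<open>The diagonal entry at \<open>z\<close> went to \<open>g\<close>, so
    \<open>h\<close> has 0 there; \<open>f z z = 0\<close> makes this agree with
    \<open>f\<close>.\<close>
  also have "list_mat h ([z] @ ys) = list_mat f ([z] @ ys)"
    using dist by (intro list_mat_cong) (auto simp: h_def zz)
  finally show ?thesis .
qed

section \<open>Determinants of induced subgraphs\<close>

lemma verts_induced: "S \<subseteq> verts G \<Longrightarrow> verts (induced G S) = S"
  by (auto simp: induced_def)

lemma adj_induced: "x \<in> S \<Longrightarrow> y \<in> S \<Longrightarrow> adj (induced G S) x y = adj G x y"
  by (simp add: adj_def induced_def)

text \<open>Lets every induced subgraph of \<open>G\<close> be evaluated with the same function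
  \<open>adj G\<close>, so that the list identities apply to graphs.\<close>

lemma graph_det_induced:
  assumes "distinct xs" "set xs = S" "S \<subseteq> verts G"
  shows "graph_det (induced G S) = det (list_mat (adj G) xs)"
proof -
  have "graph_det (induced G S) = det (list_mat (adj (induced G S)) xs)"
    using graph_det_eq[of xs "induced G S"] assms
    by (simp add: verts_induced adj_mat_eq_list_mat)
  also have "list_mat (adj (induced G S)) xs = list_mat (adj G) xs"
    using assms by (intro list_mat_cong) (auto simp: adj_induced)
  finally show ?thesis .
qed

text \<open>The determinant sees a graph only through \<open>adj\<close>. Equality of records would
  be too strict, as total weight functions may differ off the edges.\<close>

lemma graph_det_cong:
  assumes "finite (verts G)" "verts G = verts H"
    and "\<And>x y. x \<in> verts G \<Longrightarrow> y \<in> verts G \<Longrightarrow> adj G x y = adj H x y"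
  shows "graph_det G = graph_det H"
proof -
  obtain xs where xs: "distinct xs" "set xs = verts G"
    using finite_distinct_list[OF assms(1)] by blast
  then have "list_mat (adj G) xs = list_mat (adj H) xs"
    by (intro list_mat_cong) (auto intro: assms(3))
  with xs assms(2) show ?thesis
    by (simp add: graph_det_eq[of xs] adj_mat_eq_list_mat)
qed

lemma graph_det_induced_cong:
  assumes "finite S" "S \<subseteq> verts G" "S \<subseteq> verts H"
    and "\<And>x y. x \<in> S \<Longrightarrow> y \<in> S \<Longrightarrow> adj G x y = adj H x y"
  shows "graph_det (induced G S) = graph_det (induced H S)"
  using assms by (intro graph_det_cong) (simp_all add: verts_induced adj_induced)

lemma adj_commute: "adj G x y = adj G y x"
  by (simp add: adj_def insert_commute)

lemma graph_det_disjoint_union: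
  assumes "finite A" "finite B" "A \<inter> B = {}" "A \<union> B \<subseteq> verts G"
    and "\<And>x y. x \<in> A \<Longrightarrow> y \<in> B \<Longrightarrow> adj G x y = 0"
  shows "graph_det (induced G (A \<union> B)) = graph_det (induced G A) * graph_det (induced G B)"
proof -
  obtain xs ys where "distinct xs" "set xs = A" "distinct ys" "set ys = B"
    using assms(1,2) finite_distinct_list by metis
  then show ?thesis
    using assms det_list_mat_append_upper_zero[of xs ys "adj G"]
    by (simp add: graph_det_induced[of "xs @ ys" "A \<union> B"] graph_det_induced[of xs A]
        graph_det_induced[of ys B])
qed

lemma graph_det_cut_vertex:
  assumes "finite A" "finite B" "A \<inter> B = {}" "z \<notin> A" "z \<notin> B" "insert z (A \<union> B) \<subseteq> verts G"
    and "adj G z z = 0"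
    and AB: "\<And>x y. x \<in> A \<Longrightarrow> y \<in> B \<Longrightarrow> adj G x y = 0"
  shows "graph_det (induced G (insert z (A \<union> B))) =
    graph_det (induced G (insert z A)) * graph_det (induced G B) +
    graph_det (induced G A) * graph_det (induced G (insert z B))"
proof -
  obtain xs ys where "distinct xs" "set xs = A" "distinct ys" "set ys = B"
    using assms(1,2) finite_distinct_list by metis
  \<comment> \<open>Symmetry of \<open>adj\<close> turns \<open>AB\<close> into the second vanishing
    condition.\<close>
  then show ?thesis
    using assms det_list_mat_cut_vertex[of xs z ys "adj G"] AB[THEN adj_commute[THEN trans]]
    by (simp add: graph_det_induced[of "xs @ z # ys" "insert z (A \<union> B)"]
        graph_det_induced[of "xs @ [z]" "insert z A"] graph_det_induced[of "z # ys" "insert z B"]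
        graph_det_induced[of xs A] graph_det_induced[of ys B])
qed

section \<open>Adjacency in joined graphs and in the cycle\<close>

lemma signed_graph_edgeD:
  assumes "signed_graph G" "{x, y} \<in> edges G"
  shows "x \<in> verts G" "y \<in> verts G" "x \<noteq> y"
  using assms by (force simp: signed_graph_def)+

text \<open>By disjointness, two vertices on the same side form neither the new edge nor an edge of
  the other graph, so the weight lookup finds the old weight. Across the sides only the new edge is
  left, which is what makes its ends cut vertices.\<close>

lemma adj_join_edge:
  assumes G: "signed_graph G" and H: "signed_graph H" and disj: "verts G \<inter> verts H = {}"
    and u: "u \<in> verts G" and w: "w \<in> verts H"
  shows "x \<in> verts G \<Longrightarrow> y \<in> verts G \<Longrightarrow> adj (join_edge G u H w s) x y = adj G x y"
    and "x \<in> verts H \<Longrightarrow> y \<in> verts H \<Longrightarrow> adj (join_edge G u H w s) x y = adj H x y"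
    and "x \<in> verts G \<Longrightarrow> y \<in> verts H \<Longrightarrow>
      adj (join_edge G u H w s) x y = (if x = u \<and> y = w then s else 0)"
proof -
  note GD = signed_graph_edgeD[OF G] and HD = signed_graph_edgeD[OF H]
  show "adj (join_edge G u H w s) x y = adj G x y" if "x \<in> verts G" "y \<in> verts G"
  proof -
    have "{x, y} \<noteq> {u, w}" "{x, y} \<notin> edges H"
      using that disj w HD(1)[of x y] by (auto simp: doubleton_eq_iff)
    then show ?thesis
      by (simp add: adj_def join_edge_def)
  qed
  show "adj (join_edge G u H w s) x y = adj H x y" if "x \<in> verts H" "y \<in> verts H"
  proof -
    have "{x, y} \<noteq> {u, w}" "{x, y} \<notin> edges G"
      using that disj u GD(1)[of x y] by (auto simp: doubleton_eq_iff)
    then show ?thesis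
      by (simp add: adj_def join_edge_def)
  qed
  show "adj (join_edge G u H w s) x y = (if x = u \<and> y = w then s else 0)"
    if "x \<in> verts G" "y \<in> verts H"
  proof -
    have "{x, y} \<notin> edges G" "{x, y} \<notin> edges H"
      using that disj GD(2)[of x y] HD(1)[of x y] by blast+
    moreover have "{x, y} = {u, w} \<longleftrightarrow> x = u \<and> y = w"
      using that disj u w by (auto simp: doubleton_eq_iff)
    ultimately show ?thesis
      by (simp add: adj_def join_edge_def)
  qed
qed

lemma adj_self: "signed_graph G \<Longrightarrow> adj G x x = 0"
  using signed_graph_edgeD(3)[of G x x] by (auto simp: adj_def)

lemma induced_verts:
  assumes "signed_graph G"
  shows "induced G (verts G) = G"
  using assms by (intro sgraph.equality) (auto simp: induced_def signed_graph_def)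

text \<open>The index \<open>l + 1\<close> lies strictly between \<open>i\<close> and
  \<open>j\<close>, so they are not consecutive; both are at least 2, which rules out the closing
  edge \<open>{v n, v 1}\<close>.\<close>

lemma signed_cycle_adj_zero:
  assumes "signed_cycle C n v" "i \<in> {2..l}" "j \<in> {l + 2..n}"
  shows "adj C (v i) (v j) = 0"
proof -
  have inj: "v a = v b \<longleftrightarrow> a = b" if "a \<in> {1..n}" "b \<in> {1..n}" for a b
    using assms(1) that by (auto simp: signed_cycle_def inj_on_eq_iff)
  have "{v i, v j} \<notin> edges C"
    using assms by (auto simp: signed_cycle_def doubleton_eq_iff inj)
  then show ?thesis
    by (simp add: adj_def)
qed

section \<open>Expansion of the unicyclic graph at its two attachment vertices\<close>

theorem theorem10:
  fixes C T1 T2 U :: "'a sgraph" and v :: "nat \<Rightarrow> 'a" and r1 r2 :: 'a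
    and s1 s2 :: int and n l m1 m2 :: nat
  assumes "signed_cycle C n v"
    and "signed_tree T1" and "card (verts T1) = m1" and "r1 \<in> verts T1"
    and "signed_tree T2" and "card (verts T2) = m2" and "r2 \<in> verts T2"
    and "verts T1 \<inter> verts T2 = {}"
    and "verts C \<inter> verts T1 = {}" and "verts C \<inter> verts T2 = {}"
    and "s1 \<in> {1, -1}" and "s2 \<in> {1, -1}"
    and "1 \<le> l" and "l + 1 \<le> n" and "graph_dist C (v 1) (v (l + 1)) = l"
    and "U = unicyclic C v l T1 r1 s1 T2 r2 s2"
  shows "graph_det U =
      graph_det (delete U (verts T1)) * graph_det T1
    + graph_det (induced U (verts T1 \<union> {v 1})) * graph_det (induced U (verts T2 \<union> {v (l + 1)}))
        * graph_det (induced C (v ` {2..l})) * graph_det (induced C (v ` {l + 2..n}))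
    + graph_det (induced U (verts T1 \<union> {v 1})) * graph_det T2 * graph_det (delete C {v 1})"
proof -
  define W where "W = join_edge C (v (l + 1)) T2 r2 s2"
  \<comment> \<open>The vertex sets of the two paths left after removing both attachment vertices
    from the cycle. For \<open>l = 1\<close> the set \<open>P\<close> is empty and contributes the
    determinant 1.\<close>
  define P where "P = v ` {2..l}"
  define Q where "Q = v ` {l + 2..n}"
  let ?c = "v (l + 1)"
  have U: "U = join_edge W (v 1) T1 r1 s1"
    by (simp add: assms(16) W_def unicyclic_def)
  have C: "signed_graph C" and T1: "signed_graph T1" and T2: "signed_graph T2"
    using assms(1,2,5) by (auto simp: signed_cycle_def signed_tree_def)
  have inj: "v a = v b \<longleftrightarrow> a = b" if "a \<in> {1..n}" "b \<in> {1..n}" for a b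
    using assms(1) that by (auto simp: signed_cycle_def inj_on_eq_iff)
  have "{1..n} = insert 1 (insert (l + 1) ({2..l} \<union> {l + 2..n}))"
    using assms(13,14) by auto
  then have vC: "verts C = insert (v 1) (insert ?c (P \<union> Q))"
    using assms(1) by (simp add: signed_cycle_def P_def Q_def image_Un)
  have notin: "v 1 \<notin> P" "v 1 \<notin> Q" "v 1 \<noteq> ?c" "?c \<notin> P" "?c \<notin> Q" "P \<inter> Q = {}"
    using assms(13,14) by (auto simp: P_def Q_def inj)
  have fin: "finite P" "finite Q" "finite (verts T1)" "finite (verts T2)"
    using T1 T2 by (auto simp: P_def Q_def signed_graph_def)
  have vW: "verts W = verts C \<union> verts T2" and vU: "verts U = verts W \<union> verts T1"
    by (simp_all add: W_def U join_edge_def)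
  have WT1: "verts W \<inter> verts T1 = {}"
    using assms(8,9) vW by auto
  have W: "signed_graph W"
    unfolding W_def using C T2 assms(7,10,12) vC by (intro signed_graph_join_edge) auto
  have sU: "signed_graph U"
    unfolding U using W T1 WT1 assms(4,11) vC vW by (intro signed_graph_join_edge) auto
  note adjW = adj_join_edge[OF C T2 assms(10) _ assms(7), of ?c, where s = s2, folded W_def]
  note adjU = adj_join_edge[OF W T1 WT1 _ assms(4), of "v 1", where s = s1, folded U]
  have cC: "?c \<in> verts C" and cW: "v 1 \<in> verts W"
    using vC vW by auto
  have UC: "adj U x y = adj C x y" if "x \<in> verts C" "y \<in> verts C" for x y
    using adjU(1)[OF cW, of x y] adjW(1)[OF cC, of x y] that vW by simp
  have UCdet: "graph_det (induced U S) = graph_det (induced C S)" if "S \<subseteq> verts C" for S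
  proof (rule graph_det_induced_cong)
    show "finite S"
      using C that finite_subset by (auto simp: signed_graph_def)
  qed (use that UC vU vW in blast)+
  have UT2: "adj U x y = adj T2 x y" if "x \<in> verts T2" "y \<in> verts T2" for x y
    using adjU(1)[OF cW, of x y] adjW(2)[OF cC, of x y] that vW by simp
  have UT1: "adj U x y = adj T1 x y" if "x \<in> verts T1" "y \<in> verts T1" for x y
    using adjU(2)[OF cW] that by simp
  have "graph_det U = graph_det (induced U (insert (v 1) (verts T1 \<union> (verts W - {v 1}))))"
  proof -
    have "insert (v 1) (verts T1 \<union> (verts W - {v 1})) = verts U"
      using cW vU by auto
    then show ?thesis
      by (simp add: induced_verts[OF sU])
  qed
  \<comment> \<open>First cut, at \<open>v 1\<close>: the only edge from \<open>T1\<close> to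
    \<open>W\<close> ends there.\<close>
  also have "\<dots> = graph_det (induced U (insert (v 1) (verts T1))) *
        graph_det (induced U (verts W - {v 1})) +
      graph_det (induced U (verts T1)) *
        graph_det (induced U (insert (v 1) (verts W - {v 1})))"
  proof (rule graph_det_cut_vertex)
    show "adj U x y = 0" if "x \<in> verts T1" "y \<in> verts W - {v 1}" for x y
      using adjU(3)[OF cW, of y x] that by (simp add: adj_commute[of U x])
  qed (use fin W WT1 cW vU adj_self[OF sU] in \<open>auto simp: signed_graph_def\<close>)
  also have "insert (v 1) (verts W - {v 1}) = verts U - verts T1"
    using cW vU WT1 by auto
  also have "graph_det (induced U (verts T1)) = graph_det T1"
    using graph_det_induced_cong[of "verts T1" U T1] fin vU UT1 by (simp add: induced_verts[OF T1])
  also have "verts W - {v 1} = insert ?c (verts T2 \<union> (P \<union> Q))"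
    using vC vW notin assms(10) by auto
  \<comment> \<open>Second cut, at \<open>?c\<close>, with \<open>v 1\<close> already removed. Both
    arcs of the cycle stay together on the side opposite \<open>T2\<close>.\<close>
  also have "graph_det (induced U (insert ?c (verts T2 \<union> (P \<union> Q)))) =
      graph_det (induced U (insert ?c (verts T2))) * graph_det (induced U (P \<union> Q)) +
      graph_det (induced U (verts T2)) * graph_det (induced U (insert ?c (P \<union> Q)))"
  proof (rule graph_det_cut_vertex)
    show "adj U x y = 0" if "x \<in> verts T2" "y \<in> P \<union> Q" for x y
    proof -
      have "y \<in> verts C" "y \<noteq> ?c"
        using that vC notin by auto
      then show ?thesis
        using adjU(1)[OF cW, of y x] adjW(3)[OF cC, of y x] that vW
        by (simp add: adj_commute[of U x])
    qed
  qed (use fin notin vU vW vC assms(10) adj_self[OF sU] in auto)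
  also have "graph_det (induced U (verts T2)) = graph_det T2"
    using graph_det_induced_cong[of "verts T2" U T2] fin vU vW UT2
    by (auto simp: induced_verts[OF T2])
  \<comment> \<open>Here \<open>?c\<close> reconnects the two arcs to the path left by removing
    \<open>v 1\<close> from the cycle.\<close>
  also have "graph_det (induced U (insert ?c (P \<union> Q))) = graph_det (delete C {v 1})"
  proof -
    have "verts C - {v 1} = insert ?c (P \<union> Q)"
      using vC notin by auto
    then show ?thesis
      using UCdet[of "insert ?c (P \<union> Q)"] by (auto simp: delete_def)
  qed
  also have "graph_det (induced U (P \<union> Q)) = graph_det (induced C (P \<union> Q))"
    by (rule UCdet) (auto simp: vC)
  \<comment> \<open>Without \<open>v 1\<close> and \<open>?c\<close> no cycle edge joins the arcs,
    so the determinant factors.\<close>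
  also have "\<dots> = graph_det (induced C P) * graph_det (induced C Q)"
  proof (rule graph_det_disjoint_union)
    show "adj C x y = 0" if "x \<in> P" "y \<in> Q" for x y
      using that signed_cycle_adj_zero[OF assms(1)] by (auto simp: P_def Q_def)
  qed (use fin notin vC in auto)
  finally show ?thesis
    by (simp add: delete_def P_def Q_def algebra_simps)
qed

end
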